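(* Let $\mathscr{H}$ be a complex Hilbert space and let $A\in\mathbb{B}(\mathscr{H})$. Then for every real $r\geq 1$, $$\frac{1}{4}\|A^*A+AA^*\|\leq\frac{1}{2}\left(\frac{1}{2}\|\Re(A)+\Im(A)\|^{2r}+\frac{1}{2}\|\Re(A)-\Im(A)\|^{2r}\right)^{\frac{1}{r}}\leq w^{2}(A).$$
   Context: $\mathbb{B}(\mathscr{H})$ is the algebra of all bounded linear operators on the complex Hilbert space $\mathscr{H}$, and $\|\cdot\|$ is the operator norm. $\Re(A)=\frac{1}{2}(A+A^* )$ and $\Im(A)=\frac{1}{2\mathrm{i}}(A-A^* )$ (both are self-adjoint operators). The numerical radius is $w(A)=\sup\{|\langle Ax,x\rangle|: x\in\mathscr{H},\ \|x\|=1\}$, and $w^2(A)$ means $(w(A))^2$. *)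

theory Defs
  imports "HOL-Analysis.Analysis"
begin

class complex_vector = real_vector +
  fixes scaleC :: "complex \<Rightarrow> 'a \<Rightarrow> 'a"  (infixr "*\<^sub>C" 75)
  assumes scaleC_add_right: "c *\<^sub>C (x + y) = c *\<^sub>C x + c *\<^sub>C y"
    and scaleC_add_left: "(c + d) *\<^sub>C x = c *\<^sub>C x + d *\<^sub>C x"
    and scaleC_scaleC: "c *\<^sub>C d *\<^sub>C x = (c * d) *\<^sub>C x"
    and scaleC_of_real: "complex_of_real r *\<^sub>C x = r *\<^sub>R x"

text \<open>
  The complex inner product is linear in the first argument. Its real part is the
  inner product of the underlying real space, so the norm inherited from
  \<^class>\<open>real_inner\<close> is the one induced by the complex inner product, and positive
  definiteness is inherited as well.
\<close>

class complex_inner = complex_vector + real_inner +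
  fixes cinner :: "'a \<Rightarrow> 'a \<Rightarrow> complex"
  assumes cinner_commute: "cinner x y = cnj (cinner y x)"
    and cinner_add_left: "cinner (x + y) z = cinner x z + cinner y z"
    and cinner_scaleC_left: "cinner (c *\<^sub>C x) y = c * cinner x y"
    and Re_cinner: "Re (cinner x y) = inner x y"

class complex_hilbert_space = complex_inner + complete_space

lemma cinner_self: "cinner x x = complex_of_real ((norm x)\<^sup>2)"
  for x :: "'a::complex_inner"
proof (rule complex_eqI)
  show "Re (cinner x x) = Re (complex_of_real ((norm x)\<^sup>2))"
    by (simp add: Re_cinner power2_norm_eq_inner)
  have "Im (cinner x x) = - Im (cinner x x)"
    using arg_cong[OF cinner_commute[of x x], of Im] by (simp only: cnj.simps(2))
  then show "Im (cinner x x) = Im (complex_of_real ((norm x)\<^sup>2))"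
    by simp
qed

instantiation complex :: complex_hilbert_space
begin

definition scaleC_complex :: "complex \<Rightarrow> complex \<Rightarrow> complex"
  where "scaleC_complex c x = c * x"

definition cinner_complex :: "complex \<Rightarrow> complex \<Rightarrow> complex"
  where "cinner_complex x y = x * cnj y"

instance
  by standard
    (simp_all add: scaleC_complex_def cinner_complex_def algebra_simps scaleR_conv_of_real
      inner_complex_def)

end

definition bounded_clinear :: "('a::complex_inner \<Rightarrow> 'b::complex_inner) \<Rightarrow> bool"
  where "bounded_clinear A \<longleftrightarrow> bounded_linear A \<and> (\<forall>c x. A (c *\<^sub>C x) = c *\<^sub>C A x)"

text \<open>
  For a bounded operator on a Hilbert space the adjoint exists, by the Riesz
  representation theorem, and is unique.
\<close>

definition cadjoint :: "('a::complex_inner \<Rightarrow> 'a) \<Rightarrow> 'a \<Rightarrow> 'a"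
  where "cadjoint A = (THE B. \<forall>x y. cinner (A x) y = cinner x (B y))"

definition Re_op :: "('a::complex_inner \<Rightarrow> 'a) \<Rightarrow> 'a \<Rightarrow> 'a"
  where "Re_op A = (\<lambda>x. (1 / 2) *\<^sub>C (A x + cadjoint A x))"

definition Im_op :: "('a::complex_inner \<Rightarrow> 'a) \<Rightarrow> 'a \<Rightarrow> 'a"
  where "Im_op A = (\<lambda>x. (1 / (2 * \<i>)) *\<^sub>C (A x - cadjoint A x))"

text \<open>
  The supremum is taken in $[0,\infty)$: inserting 0 changes nothing when there are unit
  vectors, and makes the numerical radius 0 on the zero space, where the supremum of
  the empty set of reals would be unspecified.
\<close>

definition numerical_radius :: "('a::complex_inner \<Rightarrow> 'a) \<Rightarrow> real"
  where "numerical_radius A = Sup (insert 0 {cmod (cinner (A x) x) | x. norm x = 1})"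

end

theory Submission
  imports Defs
begin

text \<open>
  Write \<open>P\<close> and \<open>Q\<close> for the real and imaginary parts of \<open>A\<close>, and put \<open>S = P + Q\<close>, \<open>D = P - Q\<close>. All
  four operators are self-adjoint.

  The left inequality is algebra followed by convexity. Expanding \<open>A = P + \<i> Q\<close> gives
  \<open>A* A + A A* = 2 (P\<^sup>2 + Q\<^sup>2) = S\<^sup>2 + D\<^sup>2\<close> (\<open>Re_op_sq_plus_Im_op_sq\<close>), whose norm is at most
  \<open>\<parallel>S\<parallel>\<^sup>2 + \<parallel>D\<parallel>\<^sup>2\<close>. A quarter of this is half the arithmetic mean of \<open>\<parallel>S\<parallel>\<^sup>2\<close> and \<open>\<parallel>D\<parallel>\<^sup>2\<close>, which is at
  most half their power mean of exponent \<open>r\<close> (\<open>mean_le_power_mean\<close>).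

  For the right inequality it is enough that \<open>\<parallel>S\<parallel>\<close> and \<open>\<parallel>D\<parallel>\<close> are at most \<open>sqrt 2\<close> times the numerical
  radius \<open>w\<close>, since then the power mean of their squares is at most \<open>2 w\<^sup>2\<close>. With
  \<open>z = \<langle>A x, x\<rangle>\<close> the quadratic forms of \<open>S\<close> and \<open>D\<close> are \<open>Re z + Im z\<close> and \<open>Re z - Im z\<close>, both bounded
  in modulus by \<open>sqrt 2 * \<bar>z\<bar>\<close>; and the norm of a self-adjoint operator is governed by its quadratic
  form (\<open>norm_le_if_quadratic_form_le\<close>).

  All of this rests on the adjoint satisfying its defining identity (\<open>cinner_cadjoint\<close>), which is
  derived from the Riesz representation theorem.
\<close>

section \<open>Riesz representation in a real Hilbert space\<close>

text \<open>
  The Riesz representation theorem over the reals, by the direct method: a quadratic functional whose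
  minimiser must be the representing vector is bounded below, the parallelogram law makes every
  minimising sequence Cauchy, and the first variation at the limit vanishes.
\<close>

lemma bounded_linear_functional_representable:
  fixes f :: "'a::{real_inner, complete_space} \<Rightarrow> real"
  assumes "bounded_linear f"
  obtains z where "\<And>h. f h = inner h z"
proof -
  interpret f: bounded_linear f by fact
  obtain K where K: "\<And>x. \<bar>f x\<bar> \<le> norm x * K" using f.bounded by auto
  (* If f is represented by z, then J y = (norm (y - z))^2 - (norm z)^2, so z is the minimiser of J. *)
  define J where "J y = (norm y)\<^sup>2 - 2 * f y" for y
  have J_lower: "- K\<^sup>2 \<le> J y" for y
  proof -
    have "0 \<le> (norm y - K)\<^sup>2" by simp
    then have "2 * (norm y * K) \<le> (norm y)\<^sup>2 + K\<^sup>2"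
      by (simp add: power2_diff)
    with K[of y] show ?thesis unfolding J_def by linarith
  qed
  define m where "m = Inf (range J)"
  have bdd: "bdd_below (range J)" using J_lower by (intro bdd_belowI[of _ "- K\<^sup>2"]) auto
  have m_le: "m \<le> J y" for y unfolding m_def using bdd by (simp add: cINF_lower)
  have gap: "(norm (x - y))\<^sup>2 \<le> 2 * (J x + J y - 2 * m)" for x y
  proof -
    define w where "w = (1/2) *\<^sub>R (x + y)"
    (* This is the parallelogram law; the linear part of J cancels. *)
    have "J x + J y - 2 * J w = (norm (x - y))\<^sup>2 / 2"
      unfolding J_def w_def power2_norm_eq_inner f.scaleR f.add
      by (simp add: inner_simps inner_commute[of y x] field_simps)
    with m_le[of w] show ?thesis by (simp add: field_simps)
  qed
  have "\<exists>y. J y < m + inverse (real (Suc n))" for n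
  proof -
    have "Inf (range J) < m + inverse (real (Suc n))" unfolding m_def by simp
    then show ?thesis using bdd by (auto simp: cInf_less_iff)
  qed
  then obtain X where X: "\<And>n. J (X n) < m + inverse (real (Suc n))" by metis
  have "Cauchy X"
  proof (rule metric_CauchyI)
    fix e :: real assume e: "0 < e"
    then obtain N where N: "inverse (real (Suc N)) < e\<^sup>2 / 4"
      using reals_Archimedean[of "e\<^sup>2 / 4"] by auto
    have "dist (X i) (X j) < e" if "N \<le> i" "N \<le> j" for i j
    proof -
      have "inverse (real (Suc i)) \<le> inverse (real (Suc N))"
        "inverse (real (Suc j)) \<le> inverse (real (Suc N))"
        using that by (simp_all add: field_simps)
      then have "(norm (X i - X j))\<^sup>2 < e\<^sup>2"
        using gap[of "X i" "X j"] X[of i] X[of j] N by argo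
      then show ?thesis using e by (simp add: dist_norm power2_less_imp_less)
    qed
    then show "\<exists>N. \<forall>i\<ge>N. \<forall>j\<ge>N. dist (X i) (X j) < e" by blast
  qed
  then obtain z where z: "X \<longlonglongrightarrow> z" using Cauchy_convergent convergent_def by blast
  have "(\<lambda>n. J (X n)) \<longlonglongrightarrow> J z"
    unfolding J_def by (intro tendsto_intros f.tendsto z)
  moreover have "(\<lambda>n. m + inverse (real (Suc n))) \<longlonglongrightarrow> m"
    using tendsto_add[OF tendsto_const LIMSEQ_inverse_real_of_nat, of m] by simp
  ultimately have "J z \<le> m"
    using X by (intro LIMSEQ_le) (auto intro: less_imp_le)
  then have z_min: "J z \<le> J y" for y using m_le[of y] by linarith
  have "f h = inner h z" for h
  proof (cases "h = 0")
    case True then show ?thesis by (simp add: f.zero)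
  next
    case False
    define d where "d = f h - inner h z"
    (* The quadratic polynomial J (z + t h) in t is smallest at this t, where it lies below J z by
       d^2 / inner h h; minimality of z then forces d = 0. *)
    define t where "t = d / inner h h"
    have pos: "inner h h > 0" using False by simp
    have "J (z + t *\<^sub>R h) = J z - 2 * t * d + t * t * inner h h"
      unfolding J_def d_def power2_norm_eq_inner f.scaleR f.add
      by (simp add: algebra_simps inner_commute[of z h])
    with z_min[of "z + t *\<^sub>R h"] have "2 * t * d \<le> t * t * inner h h" by linarith
    then have "d * d \<le> 0" using pos unfolding t_def by (simp add: field_simps)
    then have "d = 0" by (metis mult_eq_0_iff not_square_less_zero order_le_less)
    then show ?thesis by (simp add: d_def)
  qed
  then show thesis by (rule that)
qed

section \<open>Complex inner product spaces\<close>

lemma scaleC_one [simp]: "1 *\<^sub>C x = x" for x :: "'a::complex_vector"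
  using scaleC_of_real[of 1 x] by simp

lemma scaleC_minus1: "(- 1) *\<^sub>C x = - x" for x :: "'a::complex_vector"
  using scaleC_of_real[of "-1" x] by simp

lemma scaleC_scaleR: "c *\<^sub>C (r *\<^sub>R x) = r *\<^sub>R (c *\<^sub>C x)" for x :: "'a::complex_vector"
  by (simp flip: scaleC_of_real add: scaleC_scaleC mult.commute)

lemma cinner_scaleC_right: "cinner x (c *\<^sub>C y) = cnj c * cinner x y" for x :: "'a::complex_inner"
  by (metis cinner_commute cinner_scaleC_left complex_cnj_mult)

lemma cinner_add_right: "cinner x (y + z) = cinner x y + cinner x z" for x :: "'a::complex_inner"
  by (metis cinner_add_left cinner_commute complex_cnj_add)

lemma cinner_diff_left: "cinner (x - y) z = cinner x z - cinner y z" for x :: "'a::complex_inner"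
  using cinner_add_left[of x "- y" z] cinner_scaleC_left[of "-1" y z] unfolding scaleC_minus1 by simp

lemma cinner_diff_right: "cinner z (x - y) = cinner z x - cinner z y" for x :: "'a::complex_inner"
  by (metis cinner_diff_left cinner_commute complex_cnj_diff)

text \<open>
  Recovering the imaginary part from the real inner product lets an identity between real inner
  products be lifted to the complex inner product when the operators involved commute with \<open>\<i>\<close>.
\<close>

lemma Im_cinner: "Im (cinner x y) = inner (- \<i> *\<^sub>C x) y" for x :: "'a::complex_inner"
  by (simp flip: Re_cinner add: cinner_scaleC_left)

lemma norm_scaleC: "norm (c *\<^sub>C x) = cmod c * norm x" for x :: "'a::complex_inner"
proof -
  have "complex_of_real ((norm (c *\<^sub>C x))\<^sup>2) = (c * cnj c) * cinner x x"
    unfolding cinner_self[symmetric] cinner_scaleC_left cinner_scaleC_right by (simp only: ac_simps)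
  also have "\<dots> = complex_of_real ((cmod c * norm x)\<^sup>2)"
    unfolding cinner_self complex_norm_square[symmetric] power_mult_distrib of_real_mult ..
  finally have "(norm (c *\<^sub>C x))\<^sup>2 = (cmod c * norm x)\<^sup>2"
    unfolding of_real_eq_iff .
  then show ?thesis by (rule power2_eq_imp_eq) simp_all
qed

lemma bounded_linear_scaleC: "bounded_linear (\<lambda>x::'a::complex_inner. c *\<^sub>C x)"
  by (rule bounded_linear_intro[where K = "cmod c"])
    (simp_all add: scaleC_add_right scaleC_scaleR norm_scaleC)

lemma norm_cinner_le: "cmod (cinner x y) \<le> norm x * norm y" for x :: "'a::complex_inner"
proof -
  (* The scalar c rotates the inner product onto the nonnegative real axis, which reduces the
     claim to the real Cauchy-Schwarz inequality. *)
  define c where "c = cnj (sgn (cinner x y))"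
  have c: "cmod c \<le> 1" by (simp add: c_def norm_sgn)
  have "cmod (cinner x y) = Re (c * cinner x y)"
    by (cases "cinner x y = 0")
      (simp_all add: c_def sgn_eq mult.commute[of "cnj _"] complex_norm_square[symmetric] power2_eq_square)
  also have "\<dots> = inner (c *\<^sub>C x) y" by (simp flip: Re_cinner add: cinner_scaleC_left)
  also have "\<dots> \<le> norm (c *\<^sub>C x) * norm y" by (rule norm_cauchy_schwarz)
  also have "\<dots> \<le> norm x * norm y"
    using c by (simp add: norm_scaleC mult_right_mono mult_left_le_one_le)
  finally show ?thesis .
qed

lemma cinner_eqI:
  fixes y z :: "'a::complex_inner"
  assumes "\<And>x. cinner x y = cinner x z" shows "y = z"
proof -
  have "inner (y - z) y = inner (y - z) z" using assms by (simp flip: Re_cinner)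
  then have "inner (y - z) (y - z) = 0" by (simp add: inner_diff_right)
  then show ?thesis by simp
qed

section \<open>The adjoint of a bounded operator\<close>

text \<open>
  The definite description in the definition of the adjoint is legitimate: the real Riesz theorem
  gives the adjoint for the real inner product, and complex linearity of \<open>A\<close> upgrades it to the
  complex one.
\<close>

lemma cinner_cadjoint:
  fixes A :: "'a::complex_hilbert_space \<Rightarrow> 'a"
  assumes "bounded_clinear A"
  shows "cinner (A x) y = cinner x (cadjoint A y)"
proof -
  have A: "bounded_linear A" and AC: "A (c *\<^sub>C x) = c *\<^sub>C A x" for c x
    using assms by (auto simp: bounded_clinear_def)
  have "\<exists>z. \<forall>x. inner (A x) y = inner x z" for y
    using bounded_linear_functional_representable[OF bounded_linear_inner_left_comp[OF A]] by metis
  then obtain B where B: "inner (A x) y = inner x (B y)" for x y by metis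
  have B': "cinner (A x) y = cinner x (B y)" for x y
    by (rule complex_eqI) (simp_all only: Re_cinner Im_cinner B AC[symmetric])
  have "cadjoint A = B"
    unfolding cadjoint_def
  proof (rule the_equality)
    show "\<forall>x y. cinner (A x) y = cinner x (B y)" using B' by blast
  next
    fix C :: "'a \<Rightarrow> 'a"
    assume "\<forall>x y. cinner (A x) y = cinner x (C y)"
    then have "cinner x (C y) = cinner x (B y)" for x y by (simp flip: B')
    then show "C = B" by (rule ext[OF cinner_eqI])
  qed
  with B' show ?thesis by simp
qed

lemma cinner_cadjoint_left:
  fixes A :: "'a::complex_hilbert_space \<Rightarrow> 'a"
  assumes "bounded_clinear A"
  shows "cinner (cadjoint A x) y = cinner x (A y)"
  using cinner_cadjoint[OF assms, of y x] by (metis cinner_commute)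

text \<open>
  Linearity holds because a vector is determined by its inner products with all others;
  boundedness follows from \<open>\<parallel>A* y\<parallel>\<^sup>2 = \<langle>A A* y, y\<rangle> \<le> \<parallel>A\<parallel> \<parallel>A* y\<parallel> \<parallel>y\<parallel>\<close>.
\<close>

lemma bounded_clinear_cadjoint:
  fixes A :: "'a::complex_hilbert_space \<Rightarrow> 'a"
  assumes "bounded_clinear A"
  shows "bounded_clinear (cadjoint A)"
proof -
  note adj = cinner_cadjoint[OF assms, symmetric]
  have A: "bounded_linear A" using assms by (simp add: bounded_clinear_def)
  have scale: "cadjoint A (c *\<^sub>C y) = c *\<^sub>C cadjoint A y" for c y
    by (rule cinner_eqI) (simp only: adj cinner_scaleC_right)
  have add: "cadjoint A (y + z) = cadjoint A y + cadjoint A z" for y z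
    by (rule cinner_eqI) (simp only: adj cinner_add_right)
  have scaleR: "cadjoint A (t *\<^sub>R y) = t *\<^sub>R cadjoint A y" for t y
    using scale[of "complex_of_real t" y] unfolding scaleC_of_real .
  have "norm (cadjoint A y) \<le> norm y * onorm A" for y
  proof (cases "cadjoint A y = 0")
    case True then show ?thesis by (simp add: onorm_pos_le[OF A])
  next
    case False
    let ?z = "cadjoint A y"
    have "norm ?z * norm ?z = inner ?z ?z"
      by (simp add: power2_eq_square flip: power2_norm_eq_inner)
    also have "\<dots> = inner (A ?z) y" by (simp only: Re_cinner[symmetric] adj)
    also have "\<dots> \<le> norm (A ?z) * norm y" by (rule norm_cauchy_schwarz)
    also have "\<dots> \<le> onorm A * norm ?z * norm y" by (intro mult_right_mono onorm[OF A]) simp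
    finally show ?thesis using False by (simp add: mult.commute mult.left_commute)
  qed
  then have "bounded_linear (cadjoint A)"
    by (intro bounded_linear_intro add scaleR)
  with scale show ?thesis unfolding bounded_clinear_def by blast
qed

section \<open>The real and imaginary parts of an operator\<close>

lemma bounded_linear_Re_op_Im_op:
  fixes A :: "'a::complex_hilbert_space \<Rightarrow> 'a"
  assumes "bounded_clinear A"
  shows "bounded_linear (Re_op A)" and "bounded_linear (Im_op A)"
proof -
  have A: "bounded_linear A" "bounded_linear (cadjoint A)"
    using assms bounded_clinear_cadjoint[OF assms] by (auto simp: bounded_clinear_def)
  show "bounded_linear (Re_op A)"
    unfolding Re_op_def by (rule bounded_linear_compose[OF bounded_linear_scaleC bounded_linear_add[OF A]])
  show "bounded_linear (Im_op A)"
    unfolding Im_op_def by (rule bounded_linear_compose[OF bounded_linear_scaleC bounded_linear_sub[OF A]])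
qed

lemma cinner_Re_op_Im_op_commute:
  fixes A :: "'a::complex_hilbert_space \<Rightarrow> 'a"
  assumes "bounded_clinear A"
  shows "cinner (Re_op A x) y = cinner x (Re_op A y)" and "cinner (Im_op A x) y = cinner x (Im_op A y)"
proof -
  note simps = cinner_scaleC_left cinner_scaleC_right cinner_add_left cinner_add_right
    cinner_diff_left cinner_diff_right cinner_cadjoint[OF assms] cinner_cadjoint_left[OF assms]
  show "cinner (Re_op A x) y = cinner x (Re_op A y)"
    unfolding Re_op_def simps by simp
  show "cinner (Im_op A x) y = cinner x (Im_op A y)"
    unfolding Im_op_def simps by (simp add: field_simps)
qed

text \<open>
  The quadratic form of \<open>A*\<close> is the complex conjugate of that of \<open>A\<close>.
\<close>

lemma quadratic_form_Re_op_Im_op: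
  fixes A :: "'a::complex_hilbert_space \<Rightarrow> 'a"
  assumes "bounded_clinear A"
  shows "inner (Re_op A x) x = Re (cinner (A x) x)" and "inner (Im_op A x) x = Im (cinner (A x) x)"
proof -
  have adj: "cinner (cadjoint A x) x = cnj (cinner (A x) x)"
    unfolding cinner_cadjoint_left[OF assms] by (rule cinner_commute)
  show "inner (Re_op A x) x = Re (cinner (A x) x)"
    unfolding Re_cinner[symmetric] Re_op_def cinner_scaleC_left cinner_add_left adj by simp
  show "inner (Im_op A x) x = Im (cinner (A x) x)"
    unfolding Re_cinner[symmetric] Im_op_def cinner_scaleC_left cinner_diff_left adj
    by (simp add: complex_diff_cnj Re_divide)
qed

text \<open>
  The link between the two sides of the first inequality: twice the sum of the squares of two operators
  is the sum of the squares of their sum and their difference.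
\<close>

lemma Re_op_sq_plus_Im_op_sq:
  fixes A :: "'a::complex_hilbert_space \<Rightarrow> 'a"
  assumes "bounded_clinear A"
  shows "cadjoint A (A x) + A (cadjoint A x)
    = 2 *\<^sub>R (Re_op A (Re_op A x) + Im_op A (Im_op A x))"
proof -
  have lin: "bounded_linear A" "bounded_linear (cadjoint A)"
    and AC: "A (c *\<^sub>C x) = c *\<^sub>C A x" "cadjoint A (c *\<^sub>C x) = c *\<^sub>C cadjoint A x" for c x
    using assms bounded_clinear_cadjoint[OF assms] by (auto simp: bounded_clinear_def)
  interpret A: bounded_linear A by (rule lin)
  interpret B: bounded_linear "cadjoint A" by (rule lin)
  let ?p = "A (A x)" and ?q = "A (cadjoint A x)" and ?s = "cadjoint A (A x)"
    and ?t = "cadjoint A (cadjoint A x)"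
  have half: "(1 / 2) *\<^sub>C y = (1 / 2) *\<^sub>R y" for y :: 'a
    using scaleC_of_real[of "1/2" y] by simp
  have quarter: "(1 / (2 * \<i>)) *\<^sub>C (1 / (2 * \<i>)) *\<^sub>C y = - ((1 / 4) *\<^sub>R y)" for y :: 'a
    using scaleC_of_real[of "- (1/4)" y] by (simp add: scaleC_scaleC)
  (* In the sum of these two expansions ?p and ?t cancel. *)
  have "Re_op A (Re_op A x) = (1 / 4) *\<^sub>R (?p + ?q + ?s + ?t)"
    unfolding Re_op_def half A.add B.add A.scaleR B.scaleR
    by (simp add: scaleR_add_right)
  moreover have "Im_op A (Im_op A x) = - ((1 / 4) *\<^sub>R (?p - ?q - ?s + ?t))"
    unfolding Im_op_def AC A.diff B.diff
      bounded_linear.linear[OF bounded_linear_scaleC, THEN linear_diff, symmetric] quarter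
    by (simp add: algebra_simps)
  ultimately have "Re_op A (Re_op A x) + Im_op A (Im_op A x)
      = ((1 / 4) *\<^sub>R ?q + (1 / 4) *\<^sub>R ?q) + ((1 / 4) *\<^sub>R ?s + (1 / 4) *\<^sub>R ?s)"
    by (simp add: scaleR_add_right scaleR_diff_right)
  also have "\<dots> = (1 / 2) *\<^sub>R (?s + ?q)"
    by (simp flip: scaleR_left.add add: scaleR_add_right)
  finally show ?thesis by simp
qed

section \<open>The numerical radius and norms of self-adjoint operators\<close>

text \<open>
  By polarisation, \<open>4 \<langle>T x, y\<rangle> = \<langle>T (x + y), x + y\<rangle> - \<langle>T (x - y), x - y\<rangle>\<close>, and the parallelogram law
  bounds the right-hand side by \<open>2 c (\<parallel>x\<parallel>\<^sup>2 + \<parallel>y\<parallel>\<^sup>2)\<close>. Take \<open>y\<close> in the direction of \<open>T x\<close>.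
\<close>

lemma norm_le_if_quadratic_form_le:
  fixes T :: "'a::real_inner \<Rightarrow> 'a"
  assumes "linear T" and sym: "\<And>x y. inner (T x) y = inner x (T y)"
    and le: "\<And>x. \<bar>inner (T x) x\<bar> \<le> c * (norm x)\<^sup>2"
  shows "norm (T x) \<le> c * norm x"
proof (cases "x = 0 \<or> T x = 0")
  case True
  show ?thesis
  proof (cases "x = 0")
    case True then show ?thesis by (simp add: linear_0 \<open>linear T\<close>)
  next
    case False
    have "0 \<le> c * (norm x)\<^sup>2" using le[of x] by linarith
    then have "0 \<le> c" using False by (simp add: zero_le_mult_iff)
    with True False show ?thesis by simp
  qed
next
  case False
  interpret T: linear T by fact
  (* Giving y the norm of x makes the polarisation estimate below scale correctly. *)
  define y where "y = (norm x / norm (T x)) *\<^sub>R T x"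
  have ny: "norm y = norm x" using False by (simp add: y_def)
  have "4 * (norm x * norm (T x)) = 4 * inner (T x) y"
    using False by (simp add: y_def power2_eq_square flip: power2_norm_eq_inner)
  also have "\<dots> = inner (T (x + y)) (x + y) - inner (T (x - y)) (x - y)"
    using sym[of x y]
    by (simp add: T.add T.diff inner_simps inner_commute[of "T y" x])
  also have "\<dots> \<le> c * (norm (x + y))\<^sup>2 + c * (norm (x - y))\<^sup>2"
    using le[of "x + y"] le[of "x - y"] by linarith
  also have "\<dots> = c * (2 * (norm x)\<^sup>2 + 2 * (norm y)\<^sup>2)"
    by (simp add: power2_norm_eq_inner inner_simps algebra_simps inner_commute)
  also have "\<dots> = 4 * (norm x * (c * norm x))" by (simp add: ny power2_eq_square)
  finally show ?thesis using False by simp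
qed

text \<open>
  Boundedness of \<open>A\<close> makes the supremum in the numerical radius a genuine one; rescaling to unit
  vectors turns it into an estimate for all vectors.
\<close>

lemma numerical_radius_nonneg_and_bound:
  fixes A :: "'a::complex_inner \<Rightarrow> 'a"
  assumes "bounded_clinear A"
  shows "0 \<le> numerical_radius A" and "cmod (cinner (A x) x) \<le> numerical_radius A * (norm x)\<^sup>2"
proof -
  have A: "bounded_linear A" and AC: "A (c *\<^sub>C x) = c *\<^sub>C A x" for c x
    using assms by (auto simp: bounded_clinear_def)
  interpret A: bounded_linear A by fact
  define W where "W = insert 0 {cmod (cinner (A x) x) | x. norm x = 1}"
  have "bdd_above W"
  proof (rule bdd_aboveI)
    fix v assume "v \<in> W"
    then consider "v = 0" | u where "v = cmod (cinner (A u) u)" "norm u = 1"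
      unfolding W_def by blast
    then show "v \<le> onorm A"
    proof cases
      case 2
      then show ?thesis using norm_cinner_le[of "A u" u] onorm[OF A, of u] by simp
    qed (simp add: onorm_pos_le[OF A])
  qed
  then have W: "v \<le> numerical_radius A" if "v \<in> W" for v
    using that unfolding numerical_radius_def W_def by (rule cSup_upper[rotated])
  show "0 \<le> numerical_radius A" by (rule W) (simp add: W_def)
  show "cmod (cinner (A x) x) \<le> numerical_radius A * (norm x)\<^sup>2"
  proof (cases "x = 0")
    case True then show ?thesis using cinner_self[of "0::'a"] by (simp add: A.zero)
  next
    case False
    define u where "u = complex_of_real (inverse (norm x)) *\<^sub>C x"
    have u: "norm u = 1" and x: "x = complex_of_real (norm x) *\<^sub>C u"
      using False by (simp_all add: u_def norm_scaleC scaleC_scaleC norm_inverse flip: of_real_mult)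
    have "cmod (cinner (A x) x) = (norm x)\<^sup>2 * cmod (cinner (A u) u)"
      by (subst (1 2) x) (simp add: AC cinner_scaleC_left cinner_scaleC_right norm_mult power2_eq_square)
    also have "\<dots> \<le> (norm x)\<^sup>2 * numerical_radius A"
      using u by (intro mult_left_mono W) (auto simp: W_def)
    finally show ?thesis by (simp add: mult.commute)
  qed
qed

text \<open>
  This is where the numerical radius of \<open>A\<close> enters norm estimates for the sum and the difference of
  the real and imaginary parts, with \<open>c = sqrt 2\<close>.
\<close>

lemma onorm_le_if_quadratic_form_dominated:
  fixes A :: "'a::complex_inner \<Rightarrow> 'a"
  assumes A: "bounded_clinear A" and "linear T"
    and sym: "\<And>x y. inner (T x) y = inner x (T y)"
    and le: "\<And>x. \<bar>inner (T x) x\<bar> \<le> c * cmod (cinner (A x) x)" and "0 \<le> c"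
  shows "onorm T \<le> c * numerical_radius A"
proof (rule onorm_bound)
  show "0 \<le> c * numerical_radius A"
    using numerical_radius_nonneg_and_bound(1)[OF A] \<open>0 \<le> c\<close> by simp
  show "norm (T x) \<le> c * numerical_radius A * norm x" for x
  proof (rule norm_le_if_quadratic_form_le[OF \<open>linear T\<close> sym])
    fix x
    have "c * cmod (cinner (A x) x) \<le> c * (numerical_radius A * (norm x)\<^sup>2)"
      using numerical_radius_nonneg_and_bound(2)[OF A] \<open>0 \<le> c\<close> by (rule mult_left_mono)
    with le[of x] show "\<bar>inner (T x) x\<bar> \<le> c * numerical_radius A * (norm x)\<^sup>2"
      by (simp add: mult.assoc)
  qed
qed

section \<open>The two-sided estimate\<close>

text \<open>
  Jensen's inequality for the convex function \<open>t \<mapsto> t\<^sup>r\<close>.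
\<close>

lemma mean_le_power_mean:
  fixes u v r :: real
  assumes "0 \<le> u" "0 \<le> v" "1 \<le> r"
  shows "(u + v) / 2 \<le> (1 / 2 * u powr r + 1 / 2 * v powr r) powr (1 / r)"
proof -
  (* Convexity is used on the open half-line of positive reals, so a vanishing entry is treated apart. *)
  have one_zero: "t / 2 \<le> (1 / 2 * t powr r) powr (1 / r)" if "0 \<le> t" for t
  proof -
    have "(1 / 2) powr 1 \<le> (1 / 2 :: real) powr (1 / r)"
      using assms by (intro powr_mono') auto
    then have "(1 / 2) * t \<le> (1 / 2) powr (1 / r) * t"
      using that by (intro mult_right_mono) auto
    also have "\<dots> = (1 / 2 * t powr r) powr (1 / r)"
      using assms that by (simp add: powr_divide powr_powr)
    finally show ?thesis by simp
  qed
  show ?thesis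
  proof (cases "u = 0 \<or> v = 0")
    case True
    then show ?thesis using one_zero[of u] one_zero[of v] assms by auto
  next
    case False
    then have "((1 - 1/2) *\<^sub>R u + (1/2) *\<^sub>R v) powr r \<le> (1 - 1/2) * u powr r + (1/2) * v powr r"
      using assms by (intro convex_onD[OF powr_convex]) auto
    then have "((u + v) / 2) powr r \<le> 1 / 2 * u powr r + 1 / 2 * v powr r"
      by (simp add: add_divide_distrib)
    then have "(((u + v) / 2) powr r) powr (1 / r) \<le> (1 / 2 * u powr r + 1 / 2 * v powr r) powr (1 / r)"
      using assms by (intro powr_mono2) auto
    then show ?thesis using assms by (simp add: powr_powr)
  qed
qed

text \<open>
  The squares of \<open>Re z + Im z\<close> and \<open>Re z - Im z\<close> add up to \<open>2 \<bar>z\<bar>\<^sup>2\<close>.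
\<close>

lemma abs_Re_plus_minus_Im_le:
  "\<bar>Re z + Im z\<bar> \<le> sqrt 2 * cmod z" "\<bar>Re z - Im z\<bar> \<le> sqrt 2 * cmod z"
proof -
  have "(Re z + Im z)\<^sup>2 \<le> 2 * (cmod z)\<^sup>2" "(Re z - Im z)\<^sup>2 \<le> 2 * (cmod z)\<^sup>2"
    using zero_le_power2[of "Re z - Im z"] zero_le_power2[of "Re z + Im z"]
    unfolding cmod_power2 power2_sum power2_diff by argo+
  then have "sqrt ((Re z + Im z)\<^sup>2) \<le> sqrt (2 * (cmod z)\<^sup>2)" "sqrt ((Re z - Im z)\<^sup>2) \<le> sqrt (2 * (cmod z)\<^sup>2)"
    by (simp_all only: real_sqrt_le_iff)
  then show "\<bar>Re z + Im z\<bar> \<le> sqrt 2 * cmod z" "\<bar>Re z - Im z\<bar> \<le> sqrt 2 * cmod z"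
    by (simp_all add: real_sqrt_mult)
qed

theorem theorem2p9:
  fixes A :: "'a::complex_hilbert_space \<Rightarrow> 'a" and r :: real
  assumes "bounded_clinear A" and "r \<ge> 1"
  shows "1 / 4 * onorm (\<lambda>x. cadjoint A (A x) + A (cadjoint A x))
      \<le> 1 / 2 * (1 / 2 * onorm (\<lambda>x. Re_op A x + Im_op A x) powr (2 * r)
               + 1 / 2 * onorm (\<lambda>x. Re_op A x - Im_op A x) powr (2 * r)) powr (1 / r)
    \<and> 1 / 2 * (1 / 2 * onorm (\<lambda>x. Re_op A x + Im_op A x) powr (2 * r)
               + 1 / 2 * onorm (\<lambda>x. Re_op A x - Im_op A x) powr (2 * r)) powr (1 / r)
      \<le> (numerical_radius A)\<^sup>2"
proof -
  define S where "S = (\<lambda>x. Re_op A x + Im_op A x)"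
  define D where "D = (\<lambda>x. Re_op A x - Im_op A x)"
  define w where "w = numerical_radius A"
  note PQ = bounded_linear_Re_op_Im_op[OF assms(1)]
  have lin: "bounded_linear S" "bounded_linear D"
    unfolding S_def D_def by (intro bounded_linear_add bounded_linear_sub PQ)+
  have pos: "0 \<le> onorm S" "0 \<le> onorm D" "0 \<le> w"
    using onorm_pos_le lin numerical_radius_nonneg_and_bound(1)[OF assms(1)] by (auto simp: w_def)
  have sym: "inner (S x) y = inner x (S y)" "inner (D x) y = inner x (D y)" for x y
    unfolding S_def D_def Re_cinner[symmetric] cinner_add_left cinner_add_right
      cinner_diff_left cinner_diff_right cinner_Re_op_Im_op_commute[OF assms(1)] by (rule refl)+
  have square_powr: "t powr (2 * r) = (t\<^sup>2) powr r" if "0 \<le> t" for t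
    using that powr_powr[of t 2 r] by simp
  have "onorm (\<lambda>x. cadjoint A (A x) + A (cadjoint A x)) \<le> (onorm S)\<^sup>2 + (onorm D)\<^sup>2"
  proof (rule onorm_bound)
    fix x
    interpret P: bounded_linear "Re_op A" by (rule PQ)
    interpret Q: bounded_linear "Im_op A" by (rule PQ)
    (* The mixed terms of (P + Q)^2 and (P - Q)^2 cancel. *)
    have "cadjoint A (A x) + A (cadjoint A x) = S (S x) + D (D x)"
      unfolding Re_op_sq_plus_Im_op_sq[OF assms(1)] S_def D_def P.add Q.add P.diff Q.diff scaleR_2
      by simp
    also have "norm \<dots> \<le> norm (S (S x)) + norm (D (D x))" by (rule norm_triangle_ineq)
    also have "\<dots> \<le> onorm S * norm (S x) + onorm D * norm (D x)"
      by (intro add_mono onorm lin)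
    also have "\<dots> \<le> onorm S * (onorm S * norm x) + onorm D * (onorm D * norm x)"
      by (intro add_mono mult_left_mono onorm lin pos)
    finally show "norm (cadjoint A (A x) + A (cadjoint A x)) \<le> ((onorm S)\<^sup>2 + (onorm D)\<^sup>2) * norm x"
      by (simp add: power2_eq_square algebra_simps)
  qed simp
  moreover have "((onorm S)\<^sup>2 + (onorm D)\<^sup>2) / 2
      \<le> (1 / 2 * onorm S powr (2 * r) + 1 / 2 * onorm D powr (2 * r)) powr (1 / r)"
    unfolding square_powr[OF pos(1)] square_powr[OF pos(2)]
    by (rule mean_le_power_mean) (use assms(2) in simp_all)
  ultimately have lower: "1 / 4 * onorm (\<lambda>x. cadjoint A (A x) + A (cadjoint A x))
      \<le> 1 / 2 * (1 / 2 * onorm S powr (2 * r) + 1 / 2 * onorm D powr (2 * r)) powr (1 / r)"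
    by argo
  have "onorm S \<le> sqrt 2 * w" "onorm D \<le> sqrt 2 * w"
    unfolding w_def
    by (rule onorm_le_if_quadratic_form_dominated[OF assms(1) bounded_linear.linear[OF lin(1)] sym(1)]
        onorm_le_if_quadratic_form_dominated[OF assms(1) bounded_linear.linear[OF lin(2)] sym(2)];
      simp add: S_def D_def inner_add_left inner_diff_left quadratic_form_Re_op_Im_op[OF assms(1)]
        abs_Re_plus_minus_Im_le)+
  then have "onorm S powr (2 * r) \<le> (sqrt 2 * w) powr (2 * r)" "onorm D powr (2 * r) \<le> (sqrt 2 * w) powr (2 * r)"
    using pos assms(2) by (auto intro: powr_mono2)
  then have "1 / 2 * onorm S powr (2 * r) + 1 / 2 * onorm D powr (2 * r) \<le> (sqrt 2 * w) powr (2 * r)"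
    by linarith
  then have "(1 / 2 * onorm S powr (2 * r) + 1 / 2 * onorm D powr (2 * r)) powr (1 / r)
      \<le> ((sqrt 2 * w) powr (2 * r)) powr (1 / r)"
    using assms(2) by (intro powr_mono2) auto
  also have "\<dots> = 2 * w\<^sup>2"
    using assms(2) pos(3) by (simp add: powr_powr power_mult_distrib)
  finally have upper: "1 / 2 * (1 / 2 * onorm S powr (2 * r) + 1 / 2 * onorm D powr (2 * r)) powr (1 / r) \<le> w\<^sup>2"
    by linarith
  from lower upper show ?thesis unfolding S_def D_def w_def by blast
qed

end
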